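(* Let $G$ be a simple $3$-connected graph with $n$ vertices and $m$ edges. Let $c(G)$ denote the length of a longest cycle of $G$ and $c^*(G)$ the size of a largest bond of $G$. If either (i) $c(G)\ge n-3$, or (ii) $c^*(G)\ge m-n-1$, then every longest cycle of $G$ meets every largest bond of $G$; that is, for every cycle $C$ of length $c(G)$ and every bond $B$ with $|B|=c^*(G)$, we have $E(C)\cap B\neq\emptyset$.
   Context: All graphs are simple. A bond of a graph is a minimal nonempty edge-cut. Equivalently, for a connected graph $G$, a bond is a set of edges $[X,Y]$ between the parts of a partition $V(G)=X\cup Y$ (with $X,Y$ nonempty) such that the induced subgraphs $G[X]$ and $G[Y]$ are both connected. A cycle $C$ meets a bond $B$ if they have at least one common edge. A graph is $k$-connected if it has at least $k+1$ vertices and remains connected whenever fewer than $k$ vertices are removed. *)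

theory Defs
  imports Main
begin

definition graph :: "'a set \<Rightarrow> 'a set set \<Rightarrow> bool" where
  "graph V E \<longleftrightarrow> finite V \<and> (\<forall>e\<in>E. e \<subseteq> V \<and> card e = 2)"

definition induced_connected :: "'a set \<Rightarrow> 'a set set \<Rightarrow> 'a set \<Rightarrow> bool" where
  "induced_connected V E S \<longleftrightarrow> S \<subseteq> V \<and>
     (\<forall>u\<in>S. \<forall>v\<in>S. (\<lambda>x y. x \<in> S \<and> y \<in> S \<and> {x, y} \<in> E)\<^sup>*\<^sup>* u v)"

definition connected_graph :: "'a set \<Rightarrow> 'a set set \<Rightarrow> bool" where
  "connected_graph V E \<longleftrightarrow> induced_connected V E V"

definition k_connected :: "nat \<Rightarrow> 'a set \<Rightarrow> 'a set set \<Rightarrow> bool" where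
  "k_connected k V E \<longleftrightarrow> card V \<ge> k + 1 \<and>
     (\<forall>S. S \<subseteq> V \<and> card S < k \<longrightarrow> induced_connected V E (V - S))"

definition is_cycle :: "'a set \<Rightarrow> 'a set set \<Rightarrow> 'a list \<Rightarrow> bool" where
  "is_cycle V E vs \<longleftrightarrow> length vs \<ge> 3 \<and> distinct vs \<and> set vs \<subseteq> V \<and>
     (\<forall>i < length vs. {vs ! i, vs ! ((i + 1) mod length vs)} \<in> E)"

definition cycle_edges :: "'a list \<Rightarrow> 'a set set" where
  "cycle_edges vs = {{vs ! i, vs ! ((i + 1) mod length vs)} | i. i < length vs}"

definition circumference :: "'a set \<Rightarrow> 'a set set \<Rightarrow> nat" where
  "circumference V E = Max {length vs | vs. is_cycle V E vs}"

definition edge_cut :: "'a set \<Rightarrow> 'a set set \<Rightarrow> 'a set \<Rightarrow> 'a set set" where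
  "edge_cut V E X = {e \<in> E. \<exists>x y. e = {x, y} \<and> x \<in> X \<and> y \<in> V - X}"

definition is_edge_cut :: "'a set \<Rightarrow> 'a set set \<Rightarrow> 'a set set \<Rightarrow> bool" where
  "is_edge_cut V E B \<longleftrightarrow> (\<exists>X. X \<subseteq> V \<and> B = edge_cut V E X)"

definition is_bond :: "'a set \<Rightarrow> 'a set set \<Rightarrow> 'a set set \<Rightarrow> bool" where
  "is_bond V E B \<longleftrightarrow> is_edge_cut V E B \<and> B \<noteq> {} \<and>
     (\<forall>B'. is_edge_cut V E B' \<and> B' \<noteq> {} \<and> B' \<subseteq> B \<longrightarrow> B' = B)"

definition max_bond_size :: "'a set \<Rightarrow> 'a set set \<Rightarrow> nat" where
  "max_bond_size V E = Max {card B | B. is_bond V E B}"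

end

theory Submission
  imports Defs
begin

text \<open>
  Suppose a longest cycle \<open>C\<close> avoids a largest bond. The bond separates \<open>V\<close> into two connected
  sides, and \<open>C\<close> lies in one of them; let \<open>Y\<close> be the other. Two facts drive the proof. Since \<open>C\<close>
  is longest, for a connected set \<open>D\<close> off \<open>C\<close> no two consecutive vertices of \<open>C\<close> are both attached
  to \<open>D\<close>, and attached vertices at distance two on \<open>C\<close> have a single, common neighbour in \<open>D\<close>.
  Since the bond is largest, moving vertices to the side of \<open>Y\<close> cannot enlarge it; moving one
  vertex already shows \<open>\<bar>Y\<bar> \<ge> 2\<close>.

  If at most three vertices lie off \<open>C\<close>, take an attached vertex \<open>a\<close> and its successor \<open>b\<close>. If the
  other side stays connected after moving both, \<open>a\<close> has at least three neighbours in \<open>Y\<close>, so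
  \<open>\<bar>Y\<bar> = 3\<close>, and moving also the successor of \<open>b\<close> enlarges the bond. Otherwise \<open>\<bar>Y\<bar> = 2\<close> and the
  remaining vertex off \<open>C\<close> has all its neighbours on \<open>C\<close> among \<open>a\<close>, \<open>b\<close>; by 3-connectivity this
  happens for two disjoint such pairs, which is impossible.

  If the bond has at least \<open>m - n - 1\<close> edges, let \<open>D\<close> be the component of \<open>G - C\<close> containing \<open>Y\<close>.
  Counting the edges off the bond gives at most \<open>\<bar>H\<bar> + 2\<close> edges inside \<open>H = V - D\<close>, while vertices
  of \<open>H\<close> not attached to \<open>D\<close> keep their degree \<open>\<ge> 3\<close> in \<open>H\<close>. Hence at most four vertices of \<open>C\<close>
  are unattached, at least three are attached, and the two facts about \<open>C\<close> force a common
  neighbour of all attached vertices in \<open>D\<close>, which would be a cut vertex.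
\<close>

section \<open>Neighbourhoods and elementary facts about graphs\<close>

definition nbrs :: "'a set set \<Rightarrow> 'a set \<Rightarrow> 'a \<Rightarrow> 'a set" where
  "nbrs E S x = {t \<in> S. {x, t} \<in> E}"

lemma graph_finite: "graph V E \<Longrightarrow> finite V" "graph V E \<Longrightarrow> finite E"
proof -
  assume g: "graph V E"
  then show f: "finite V" by (simp add: graph_def)
  have "E \<subseteq> Pow V" using g by (auto simp: graph_def)
  then show "finite E" using f by (meson finite_Pow_iff finite_subset)
qed

lemma graph_edgeD:
  assumes "graph V E" "{x, y} \<in> E"
  shows "x \<in> V" "y \<in> V" "x \<noteq> y"
proof -
  have *: "{x, y} \<subseteq> V" "card {x, y} = 2" using assms by (auto simp: graph_def)
  then show "x \<in> V" "y \<in> V" by auto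
  show "x \<noteq> y" using *(2) by auto
qed

lemma graph_no_loop: "graph V E \<Longrightarrow> {x} \<notin> E"
  using graph_edgeD(3)[of V E x x] by auto

lemma graph_edgeE:
  assumes "graph V E" "e \<in> E"
  obtains x y where "e = {x, y}" "x \<noteq> y" "x \<in> V" "y \<in> V"
proof -
  have "e \<subseteq> V" "card e = 2" using assms by (auto simp: graph_def)
  then show thesis using that by (auto simp: card_2_iff)
qed

subsection \<open>Connectivity\<close>

text \<open>Trades reachability for the cut form of connectivity. Conversely, if every proper part
  has a leaving edge, the set of vertices reachable from \<open>u\<close> must be all of
  \<open>S\<close>.\<close>

lemma induced_connected_iff:
  "induced_connected V E S \<longleftrightarrow> S \<subseteq> V \<and>
     (\<forall>T. T \<subseteq> S \<and> T \<noteq> {} \<and> T \<noteq> S \<longrightarrow> (\<exists>t\<in>T. \<exists>s\<in>S - T. {t, s} \<in> E))"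
  (is "?L \<longleftrightarrow> ?R")
proof
  assume L: ?L
  have "\<exists>t\<in>T. \<exists>s\<in>S - T. {t, s} \<in> E" if T: "T \<subseteq> S" "T \<noteq> {}" "T \<noteq> S" for T
  proof (rule ccontr)
    assume no: "\<not> ?thesis"
    obtain u where u: "u \<in> T" using T by auto
    obtain v where v: "v \<in> S" "v \<notin> T" using T by auto
    have "(\<lambda>x y. x \<in> S \<and> y \<in> S \<and> {x, y} \<in> E)\<^sup>*\<^sup>* u v"
      using L u v T unfolding induced_connected_def by blast
    then have "v \<in> T"
      by (induction rule: rtranclp_induct) (use u no in auto)
    then show False using v by simp
  qed
  then show ?R using L by (auto simp: induced_connected_def)
next
  assume R: ?R
  have "(\<lambda>x y. x \<in> S \<and> y \<in> S \<and> {x, y} \<in> E)\<^sup>*\<^sup>* u v" (is "?r\<^sup>*\<^sup>* u v")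
    if "u \<in> S" "v \<in> S" for u v
  proof (rule ccontr)
    assume n: "\<not> ?r\<^sup>*\<^sup>* u v"
    define T where "T = {w \<in> S. ?r\<^sup>*\<^sup>* u w}"
    have "T \<subseteq> S" "T \<noteq> {}" "T \<noteq> S" using that n by (auto simp: T_def)
    then obtain t s where ts: "t \<in> T" "s \<in> S - T" "{t, s} \<in> E" using R by meson
    then have "?r\<^sup>*\<^sup>* u t" "?r t s" by (auto simp: T_def)
    then have "?r\<^sup>*\<^sup>* u s" by (rule rtranclp.rtrancl_into_rtrancl)
    then show False using ts by (auto simp: T_def)
  qed
  then show ?L using R by (auto simp: induced_connected_def)
qed

lemma induced_connected_edge:
  assumes "induced_connected V E S" "T \<subseteq> S" "T \<noteq> {}" "T \<noteq> S"
  obtains t s where "t \<in> T" "s \<in> S - T" "{t, s} \<in> E"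
  using assms unfolding induced_connected_iff by metis

lemma induced_connected_insert:
  assumes "induced_connected V E S" "s \<in> S" "{z, s} \<in> E" "z \<in> V"
  shows "induced_connected V E (insert z S)"
  unfolding induced_connected_iff
proof (intro conjI allI impI)
  show "insert z S \<subseteq> V" using assms by (auto simp: induced_connected_def)
  fix T assume T: "T \<subseteq> insert z S \<and> T \<noteq> {} \<and> T \<noteq> insert z S"
  show "\<exists>t\<in>T. \<exists>s\<in>insert z S - T. {t, s} \<in> E"
  proof (cases "T \<inter> S = {} \<or> S \<subseteq> T")
    case True
    then show ?thesis
    proof
      assume "T \<inter> S = {}"
      then have "T = {z}" "z \<notin> S" using T by auto
      then show ?thesis using assms by auto
    next
      assume "S \<subseteq> T"
      then have "z \<notin> T" "s \<in> T" using T assms by auto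
      moreover have "{s, z} \<in> E" using assms by (simp add: insert_commute)
      ultimately show ?thesis by auto
    qed
  next
    case False
    then have "T \<inter> S \<subseteq> S" "T \<inter> S \<noteq> {}" "T \<inter> S \<noteq> S" by auto
    from induced_connected_edge[OF assms(1) this]
    obtain t s where "t \<in> T \<inter> S" "s \<in> S - T \<inter> S" "{t, s} \<in> E" by metis
    then show ?thesis by auto
  qed
qed

lemma induced_connected_path:
  assumes "successively (\<lambda>x y. {x, y} \<in> E) xs" "set xs \<subseteq> V"
  shows "induced_connected V E (set xs)"
  using assms
proof (induction xs)
  case Nil
  then show ?case by (simp add: induced_connected_def)
next
  case (Cons x xs)
  show ?case
  proof (cases xs)
    case Nil
    then show ?thesis using Cons.prems by (auto simp: induced_connected_def)
  next
    case (Cons y ys)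
    have "induced_connected V E (set xs)" "{x, y} \<in> E" "y \<in> set xs" "x \<in> V"
      using Cons.IH Cons.prems local.Cons by auto
    from induced_connected_insert[OF this(1,3,2,4)] show ?thesis by simp
  qed
qed

text \<open>The end vertices of simple paths from \<open>y\<close> form a part of \<open>D\<close>
  without leaving edges. An extension that returns to the path is replaced by an initial piece of
  it.\<close>

lemma induced_connected_obtain_path:
  assumes "induced_connected V E D" "y \<in> D" "y' \<in> D"
  obtains ps where "successively (\<lambda>x y. {x, y} \<in> E) ps" "distinct ps" "set ps \<subseteq> D"
    "ps \<noteq> []" "hd ps = y" "last ps = y'"
proof -
  define P where "P v ps \<longleftrightarrow> successively (\<lambda>x y. {x, y} \<in> E) ps \<and> distinct ps \<and> set ps \<subseteq> D \<and>
    ps \<noteq> [] \<and> hd ps = y \<and> last ps = v" for v ps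
  define T where "T = {v \<in> D. \<exists>ps. P v ps}"
  have "P y [y]" using assms by (auto simp: P_def)
  then have yT: "y \<in> T" using assms by (auto simp: T_def)
  have "T = D"
  proof (rule ccontr)
    assume "T \<noteq> D"
    moreover have "T \<subseteq> D" "T \<noteq> {}" using yT by (auto simp: T_def)
    ultimately obtain t s where ts: "t \<in> T" "s \<in> D - T" "{t, s} \<in> E"
      using induced_connected_edge[OF assms(1)] by metis
    then obtain ps where ps: "P t ps" by (auto simp: T_def)
    have "\<exists>qs. P s qs"
    proof (cases "s \<in> set ps")
      case True
      then obtain us vs where "ps = us @ s # vs" by (meson split_list)
      then have "P s (us @ [s])" using ps
        by (cases us) (auto simp: P_def successively_append_iff successively_Cons hd_append)
      then show ?thesis ..
    next
      case False
      then have "P s (ps @ [s])" using ps ts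
        by (auto simp: P_def successively_append_iff)
      then show ?thesis ..
    qed
    then show False using ts by (auto simp: T_def)
  qed
  then show thesis using assms that by (auto simp: T_def P_def)
qed

text \<open>The count behind spanning trees: an edge \<open>{w, s}\<close> leaving \<open>W\<close>
  is not incident with \<open>W - {w}\<close>, so each vertex removed from \<open>W\<close> accounts
  for an edge of its own.\<close>

lemma card_incident_edges_ge:
  assumes "graph V E" "induced_connected V E S" "W \<subset> S"
  shows "card W \<le> card {e \<in> E. e \<subseteq> S \<and> e \<inter> W \<noteq> {}}"
  using assms(3)
proof (induction "card W" arbitrary: W)
  case 0
  then show ?case by simp
next
  case (Suc k)
  have fin: "finite V" "finite E" using graph_finite assms(1) by auto
  have finW: "finite W" using Suc.hyps(2) by (metis card.infinite nat.distinct(1))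
  have "W \<noteq> {}" using Suc.hyps by auto
  then obtain w s where ws: "w \<in> W" "s \<in> S - W" "{w, s} \<in> E"
    using induced_connected_edge[OF assms(2), of W] Suc.prems by (metis psubset_eq)
  have c: "card (W - {w}) = k" using Suc.hyps ws finW by simp
  have "W - {w} \<subset> S" using Suc.prems by auto
  then have IH: "k \<le> card {e \<in> E. e \<subseteq> S \<and> e \<inter> (W - {w}) \<noteq> {}}" (is "_ \<le> card ?F")
    using Suc.hyps(1)[of "W - {w}"] c by simp
  have "{w, s} \<notin> ?F" using ws by auto
  then have "Suc k \<le> card (insert {w, s} ?F)" using IH fin by simp
  also have "\<dots> \<le> card {e \<in> E. e \<subseteq> S \<and> e \<inter> W \<noteq> {}}"
    by (rule card_mono) (use fin ws Suc.prems in auto)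
  finally show ?case using Suc.hyps by simp
qed

lemma k_connected_edge:
  assumes "k_connected k V E" "S \<subseteq> V" "card S < k" "D \<subseteq> V - S" "D \<noteq> {}" "D \<noteq> V - S"
  obtains t s where "t \<in> D" "s \<in> V - S - D" "{t, s} \<in> E"
  using assms induced_connected_edge[of V E "V - S" D] unfolding k_connected_def by metis

lemma nbrs_iff [simp]: "t \<in> nbrs E S x \<longleftrightarrow> t \<in> S \<and> {x, t} \<in> E"
  by (simp add: nbrs_def)

lemma finite_nbrs: "finite S \<Longrightarrow> finite (nbrs E S x)"
  by (simp add: nbrs_def)

text \<open>Otherwise the fewer than \<open>k\<close> neighbours of \<open>v\<close> would separate
  it from the rest, which is nonempty because \<open>card V \<ge> k + 1\<close>.\<close>

lemma k_connected_degree: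
  assumes "graph V E" "k_connected k V E" "v \<in> V"
  shows "k \<le> card (nbrs E V v)"
proof (rule ccontr)
  assume "\<not> ?thesis"
  then have c: "card (nbrs E V v) < k" by simp
  have v: "v \<notin> nbrs E V v" using graph_no_loop[OF assms(1)] by auto
  have "card (insert v (nbrs E V v)) < card V"
    using c assms(2) by (simp add: k_connected_def card_insert_if graph_finite[OF assms(1)] finite_nbrs)
  moreover have "insert v (nbrs E V v) \<subseteq> V" using assms by auto
  ultimately have "{v} \<noteq> V - nbrs E V v" by (metis Un_Diff_cancel insert_is_Un nat_neq_iff sup.absorb2 sup_commute subset_insertI subset_trans Diff_partition)
  then obtain t s where "t \<in> {v}" "s \<in> V - nbrs E V v - {v}" "{t, s} \<in> E"
    using k_connected_edge[OF assms(2) _ c, of "{v}"] v assms(3)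
    by (metis (no_types, lifting) Diff_iff empty_not_insert empty_subsetI insert_subset nbrs_iff subsetI)
  then show False by auto
qed

subsection \<open>Cuts and bonds\<close>

lemma edge_cut_iff:
  "{x, y} \<in> edge_cut V E X \<longleftrightarrow>
    {x, y} \<in> E \<and> (x \<in> X \<and> y \<in> V - X \<or> y \<in> X \<and> x \<in> V - X)"
  by (auto simp: edge_cut_def doubleton_eq_iff)

lemma edge_cut_subset: "edge_cut V E X \<subseteq> E"
  by (auto simp: edge_cut_def)

lemma edge_cut_compl:
  assumes "graph V E" "X \<subseteq> V"
  shows "edge_cut V E (V - X) = edge_cut V E X"
proof -
  have "e \<in> edge_cut V E (V - X) \<longleftrightarrow> e \<in> edge_cut V E X" if eE: "e \<in> E" for e
  proof -
    obtain x y where "e = {x, y}" using graph_edgeE[OF assms(1) eE] by metis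
    then show ?thesis using edge_cut_iff[of _ _ V E] assms(2) by auto
  qed
  then show ?thesis using edge_cut_subset by blast
qed

text \<open>If a part \<open>T\<close> of a side had no edge to the rest of that side, its cut would
  be a nonempty subset of \<open>B\<close>, hence all of \<open>B\<close> by minimality. But
  \<open>X - T\<close> also sends an edge across \<open>B\<close>, and that edge is not in the cut
  of \<open>T\<close>.\<close>

lemma bond_obtain_sides:
  assumes g: "graph V E" and con: "connected_graph V E" and B: "is_bond V E B"
  obtains X where "X \<subseteq> V" "B = edge_cut V E X" "X \<noteq> {}" "V - X \<noteq> {}"
    "induced_connected V E X" "induced_connected V E (V - X)"
proof -
  note eci = edge_cut_iff[of _ _ V E]
  have side: "induced_connected V E X" if X: "X \<subseteq> V" "B = edge_cut V E X" "B \<noteq> {}" for X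
    unfolding induced_connected_iff
  proof (intro conjI allI impI)
    show "X \<subseteq> V" by fact
    fix T assume T: "T \<subseteq> X \<and> T \<noteq> {} \<and> T \<noteq> X"
    show "\<exists>t\<in>T. \<exists>s\<in>X - T. {t, s} \<in> E"
    proof (rule ccontr)
      assume no: "\<not> ?thesis"
      have sub: "edge_cut V E T \<subseteq> B"
      proof
        fix e assume e: "e \<in> edge_cut V E T"
        then obtain x y where xy: "e = {x, y}" "x \<in> T" "y \<in> V - T" "e \<in> E" by (auto simp: edge_cut_def)
        then have "y \<notin> X" using no by auto
        then show "e \<in> B" using xy T X eci by auto
      qed
      have ne: "edge_cut V E T \<noteq> {}"
      proof -
        have "T \<subseteq> V" "T \<noteq> {}" "T \<noteq> V" using T X by auto
        then obtain t s where "t \<in> T" "s \<in> V - T" "{t, s} \<in> E"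
          using con induced_connected_edge unfolding connected_graph_def by metis
        then show ?thesis using eci by blast
      qed
      have "is_edge_cut V E (edge_cut V E T)" unfolding is_edge_cut_def using T X by blast
      then have eq: "edge_cut V E T = B" using B sub ne by (auto simp: is_bond_def)
      have "X - T \<subseteq> V" "X - T \<noteq> {}" "X - T \<noteq> V" using T X by auto
      then obtain t s where ts: "t \<in> X - T" "s \<in> V - (X - T)" "{t, s} \<in> E"
        using con induced_connected_edge unfolding connected_graph_def by metis
      have "{s, t} \<in> E" using ts by (simp add: insert_commute)
      then have "s \<notin> T" using no ts by auto
      then have "{t, s} \<in> B" "{t, s} \<notin> edge_cut V E T" using ts X eci by auto
      then show False using eq by simp
    qed
  qed
  obtain X where X: "X \<subseteq> V" "B = edge_cut V E X" "B \<noteq> {}"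
    using B by (auto simp: is_bond_def is_edge_cut_def)
  have "B = edge_cut V E (V - X)" using X edge_cut_compl[OF g] by simp
  moreover have "X \<noteq> {}" "V - X \<noteq> {}" using X by (auto simp: edge_cut_def)
  ultimately show thesis using that[OF X(1,2)] side[of X] side[of "V - X"] X by auto
qed

text \<open>A set \<open>Z\<close> whose cut lies inside that of \<open>X\<close> cannot split
  either connected side, so \<open>Z\<close> is one of the two sides.\<close>

lemma is_bondI:
  assumes g: "graph V E" and con: "connected_graph V E" and X: "X \<subseteq> V" "X \<noteq> {}" "V - X \<noteq> {}"
    and cX: "induced_connected V E X" and cY: "induced_connected V E (V - X)"
  shows "is_bond V E (edge_cut V E X)"
proof -
  note eci = edge_cut_iff[of _ _ V E]
  obtain t s where "t \<in> X" "s \<in> V - X" "{t, s} \<in> E"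
    using con X induced_connected_edge[of V E V X] unfolding connected_graph_def by auto
  then have ne: "edge_cut V E X \<noteq> {}" using eci by blast
  have "edge_cut V E Z = edge_cut V E X"
    if Z: "Z \<subseteq> V" "edge_cut V E Z \<noteq> {}" "edge_cut V E Z \<subseteq> edge_cut V E X" for Z
  proof -
    have triv: "Z \<inter> S = {} \<or> S \<subseteq> Z" if S: "S = X \<or> S = V - X" for S
    proof (rule ccontr)
      assume n: "\<not> ?thesis"
      have "induced_connected V E S" using S cX cY by auto
      moreover have "Z \<inter> S \<subseteq> S" "Z \<inter> S \<noteq> {}" "Z \<inter> S \<noteq> S" using n by auto
      ultimately obtain t s where ts: "t \<in> Z \<inter> S" "s \<in> S - Z \<inter> S" "{t, s} \<in> E"
        using induced_connected_edge by metis
      then have "{t, s} \<in> edge_cut V E Z" using eci S X by auto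
      then have "{t, s} \<in> edge_cut V E X" using Z by auto
      then show False using eci ts S by auto
    qed
    have "Z \<noteq> {}" "Z \<noteq> V" using Z by (auto simp: edge_cut_def)
    then have "Z = X \<or> Z = V - X" using triv[of X] triv[of "V - X"] Z(1) X by blast
    then show ?thesis using edge_cut_compl[OF g X(1)] by auto
  qed
  then show ?thesis using ne X unfolding is_bond_def is_edge_cut_def by metis
qed

lemma bond_le_max_bond_size:
  assumes "graph V E" "is_bond V E B"
  shows "card B \<le> max_bond_size V E"
proof -
  have "{card B | B. is_bond V E B} \<subseteq> card ` Pow E"
    by (auto simp: is_bond_def is_edge_cut_def edge_cut_def)
  then have "finite {card B | B. is_bond V E B}"
    using graph_finite(2)[OF assms(1)] by (meson finite_Pow_iff finite_imageI finite_subset)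
  then show ?thesis unfolding max_bond_size_def using assms(2) by (intro Max_ge) auto
qed

lemma cycle_le_circumference:
  assumes "graph V E" "is_cycle V E C"
  shows "length C \<le> circumference V E"
proof -
  have "length vs \<le> card V" if "is_cycle V E vs" for vs
    using that graph_finite(1)[OF assms(1)] distinct_card[of vs] card_mono[of V "set vs"]
    by (simp add: is_cycle_def)
  then have "{length vs | vs. is_cycle V E vs} \<subseteq> {..card V}" by auto
  then have "finite {length vs | vs. is_cycle V E vs}" by (meson finite_atMost finite_subset)
  then show ?thesis unfolding circumference_def using assms(2) by (intro Max_ge) auto
qed

section \<open>Counting cut edges and degrees\<close>

text \<open>When \<open>a\<close> changes sides, its edges to \<open>Y\<close> leave the cut and its
  edges to \<open>V - Y\<close> enter it. The sum form avoids subtraction of naturals.\<close>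

lemma card_edge_cut_insert:
  assumes g: "graph V E" and Y: "Y \<subseteq> V" "a \<in> V - Y"
  shows "card (edge_cut V E (insert a Y)) + card (nbrs E Y a) =
    card (edge_cut V E Y) + card (nbrs E (V - Y) a)"
proof -
  note eci = edge_cut_iff[of _ _ V E]
  have fin: "finite V" "finite E" using graph_finite g by auto
  have finY: "finite Y" using Y fin finite_subset by auto
  let ?N = "(\<lambda>t. {a, t}) ` nbrs E Y a" and ?M = "(\<lambda>t. {a, t}) ` nbrs E (V - Y) a"
  have inj: "inj_on (\<lambda>t. {a, t}) S" for S by (auto simp: inj_on_def doubleton_eq_iff)
  have cN: "card ?N = card (nbrs E Y a)" "card ?M = card (nbrs E (V - Y) a)"
    using inj card_image by blast+
  have N: "?N \<subseteq> edge_cut V E Y" using Y eci by auto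
  have M: "?M \<subseteq> edge_cut V E (insert a Y)" using Y eci graph_no_loop[OF g] by auto
  have eq: "edge_cut V E Y - ?N = edge_cut V E (insert a Y) - ?M"
  proof -
    have "e \<in> edge_cut V E Y - ?N \<longleftrightarrow> e \<in> edge_cut V E (insert a Y) - ?M" if eE: "e \<in> E" for e
    proof -
      obtain x y where e: "e = {x, y}" "x \<noteq> y" "x \<in> V" "y \<in> V" using graph_edgeE[OF g eE] by metis
      have eN: "e \<in> ?N \<longleftrightarrow> (x = a \<and> y \<in> Y \<or> y = a \<and> x \<in> Y)"
        using eE e by (auto simp: doubleton_eq_iff insert_commute)
      have eM: "e \<in> ?M \<longleftrightarrow> (x = a \<and> y \<in> V - Y \<or> y = a \<and> x \<in> V - Y)"
        using eE e by (auto simp: doubleton_eq_iff insert_commute)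
      show ?thesis unfolding Diff_iff eN eM unfolding e(1) eci using eE e Y by auto
    qed
    then show ?thesis using edge_cut_subset by blast
  qed
  have fc: "finite (edge_cut V E Z)" for Z using fin edge_cut_subset finite_subset by metis
  have "card (edge_cut V E Y - ?N) + card ?N = card (edge_cut V E Y)"
    using N fc by (metis card_Diff_subset card_mono finite_subset le_add_diff_inverse2)
  moreover have "card (edge_cut V E (insert a Y) - ?M) + card ?M = card (edge_cut V E (insert a Y))"
    using M fc by (metis card_Diff_subset card_mono finite_subset le_add_diff_inverse2)
  ultimately show ?thesis using eq cN by simp
qed

text \<open>The handshake count in the subgraph induced on \<open>H\<close>.\<close>

lemma sum_card_nbrs:
  assumes g: "graph V E" and H: "H \<subseteq> V"
  shows "(\<Sum>h\<in>H. card (nbrs E H h)) = 2 * card {e \<in> E. e \<subseteq> H}"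
proof -
  let ?F = "{e \<in> E. e \<subseteq> H}"
  have fin: "finite H" "finite ?F" using graph_finite[OF g] H finite_subset by auto
  have "card (nbrs E H h) = card {e \<in> ?F. h \<in> e}" if h: "h \<in> H" for h
  proof -
    have "bij_betw (\<lambda>t. {h, t}) (nbrs E H h) {e \<in> ?F. h \<in> e}"
      unfolding bij_betw_def
    proof
      show "inj_on (\<lambda>t. {h, t}) (nbrs E H h)" by (auto simp: inj_on_def doubleton_eq_iff)
      have "e \<in> (\<lambda>t. {h, t}) ` nbrs E H h" if e: "e \<in> E" "e \<subseteq> H" "h \<in> e" for e
      proof -
        obtain x y where "e = {x, y}" using graph_edgeE[OF g e(1)] by metis
        then show ?thesis using e by (auto simp: insert_commute)
      qed
      then show "(\<lambda>t. {h, t}) ` nbrs E H h = {e \<in> ?F. h \<in> e}" using h by auto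
    qed
    then show ?thesis by (rule bij_betw_same_card)
  qed
  then have "(\<Sum>h\<in>H. card (nbrs E H h)) = (\<Sum>h\<in>H. card {e \<in> ?F. h \<in> e})" by simp
  also have "\<dots> = 2 * card ?F"
  proof (rule sum_multicount[OF fin])
    show "\<forall>e\<in>?F. card {h \<in> H. h \<in> e} = 2"
    proof
      fix e assume e: "e \<in> ?F"
      then have "{h \<in> H. h \<in> e} = e" by auto
      then show "card {h \<in> H. h \<in> e} = 2" using e g by (simp add: graph_def)
    qed
  qed
  finally show ?thesis .
qed

subsection \<open>Cyclic sequences\<close>

text \<open>Successive \<open>Q\<close> entries are separated by a non-\<open>Q\<close> entry; the
  \<open>+ 1\<close> is for lists that begin and end in \<open>Q\<close>.\<close>

lemma length_filter_alternating:
  assumes "successively (\<lambda>x y. \<not> (Q x \<and> Q y)) xs"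
  shows "length (filter Q xs) \<le> length (filter (\<lambda>x. \<not> Q x) xs) + 1"
  using assms by (induction xs rule: induct_list012) (auto simp: successively_Cons)

text \<open>The \<open>Q\<close> entries cut the cyclic list into at least three nonempty gaps of
  total size at most four, so at most one gap has more than one entry. Across all other gaps
  \<open>jump\<close> applies, and these links chain all values of \<open>f\<close> together. Later
  \<open>Q\<close> is attachment to a set off the cycle and \<open>f\<close> picks a neighbour
  there.\<close>

lemma cyclic_alternating:
  assumes step: "\<And>i a b rs. rotate i xs = a # b # rs \<Longrightarrow> \<not> (Q a \<and> Q b)"
    and jump: "\<And>i a b c rs. rotate i xs = a # b # c # rs \<Longrightarrow> Q a \<Longrightarrow> Q c \<Longrightarrow> f a = f c"
    and few: "length (filter (\<lambda>x. \<not> Q x) xs) \<le> 4" and many: "3 \<le> length (filter Q xs)"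
    and xy: "x \<in> set xs" "Q x" "y \<in> set xs" "Q y"
  shows "f x = f y"
proof -
  have "successively (\<lambda>x y. \<not> (Q x \<and> Q y)) xs"
    unfolding successively_conv_nth
  proof (intro allI impI)
    fix i assume i: "Suc i < length xs"
    have "rotate i xs = xs ! i # xs ! Suc i # drop (Suc (Suc i)) xs @ take i xs"
      using i by (simp add: rotate_drop_take Cons_nth_drop_Suc[symmetric])
    then show "\<not> (Q (xs ! i) \<and> Q (xs ! Suc i))" using step by blast
  qed
  \<comment> \<open>The linear bound ignores the wrap-around and so admits length nine, which the
    cyclic condition then excludes. Lengths below six have no room for three pairwise nonadjacent
    entries.\<close>
  then have "length (filter Q xs) \<le> 5" using length_filter_alternating few by fastforce
  moreover have "length xs = length (filter Q xs) + length (filter (\<lambda>x. \<not> Q x) xs)"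
    by (rule sum_length_filter_compl[symmetric])
  ultimately have "length xs \<in> {3,4,5,6,7,8,9}" using few many by auto
  \<comment> \<open>Every remaining length is settled by splitting on which entries satisfy \<open>Q\<close>.\<close>
  moreover have False if len: "length xs = 3"
  proof -
    obtain x0 x1 x2 where xs: "xs = [x0, x1, x2]"
      using len by (auto simp: numeral_eq_Suc length_Suc_conv)
    have steps: "\<not> (Q x0 \<and> Q x1)" "\<not> (Q x1 \<and> Q x2)" "\<not> (Q x2 \<and> Q x0)"
      using step[of 0] step[of "Suc (0)"] step[of "Suc (Suc (0))"] unfolding xs by simp_all
    show False using few many steps unfolding xs by (auto split: if_splits)
  qed
  moreover have False if len: "length xs = 4"
  proof -
    obtain x0 x1 x2 x3 where xs: "xs = [x0, x1, x2, x3]"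
      using len by (auto simp: numeral_eq_Suc length_Suc_conv)
    have steps: "\<not> (Q x0 \<and> Q x1)" "\<not> (Q x1 \<and> Q x2)" "\<not> (Q x2 \<and> Q x3)" "\<not> (Q x3 \<and> Q x0)"
      using step[of 0] step[of "Suc (0)"] step[of "Suc (Suc (0))"] step[of "Suc (Suc (Suc (0)))"] unfolding xs by simp_all
    show False using few many steps unfolding xs by (auto split: if_splits)
  qed
  moreover have False if len: "length xs = 5"
  proof -
    obtain x0 x1 x2 x3 x4 where xs: "xs = [x0, x1, x2, x3, x4]"
      using len by (auto simp: numeral_eq_Suc length_Suc_conv)
    have steps: "\<not> (Q x0 \<and> Q x1)" "\<not> (Q x1 \<and> Q x2)" "\<not> (Q x2 \<and> Q x3)" "\<not> (Q x3 \<and> Q x4)" "\<not> (Q x4 \<and> Q x0)"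
      using step[of 0] step[of "Suc (0)"] step[of "Suc (Suc (0))"] step[of "Suc (Suc (Suc (0)))"] step[of "Suc (Suc (Suc (Suc (0))))"] unfolding xs by simp_all
    show False using few many steps unfolding xs by (auto split: if_splits)
  qed
  moreover have "f x = f y" if len: "length xs = 6"
  proof -
    obtain x0 x1 x2 x3 x4 x5 where xs: "xs = [x0, x1, x2, x3, x4, x5]"
      using len by (auto simp: numeral_eq_Suc length_Suc_conv)
    have steps: "\<not> (Q x0 \<and> Q x1)" "\<not> (Q x1 \<and> Q x2)" "\<not> (Q x2 \<and> Q x3)" "\<not> (Q x3 \<and> Q x4)" "\<not> (Q x4 \<and> Q x5)" "\<not> (Q x5 \<and> Q x0)"
      using step[of 0] step[of "Suc (0)"] step[of "Suc (Suc (0))"] step[of "Suc (Suc (Suc (0)))"] step[of "Suc (Suc (Suc (Suc (0))))"] step[of "Suc (Suc (Suc (Suc (Suc (0)))))"] unfolding xs by simp_all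
    have jumps: "Q x0 \<Longrightarrow> Q x2 \<Longrightarrow> f x0 = f x2" "Q x1 \<Longrightarrow> Q x3 \<Longrightarrow> f x1 = f x3" "Q x2 \<Longrightarrow> Q x4 \<Longrightarrow> f x2 = f x4" "Q x3 \<Longrightarrow> Q x5 \<Longrightarrow> f x3 = f x5" "Q x4 \<Longrightarrow> Q x0 \<Longrightarrow> f x4 = f x0" "Q x5 \<Longrightarrow> Q x1 \<Longrightarrow> f x5 = f x1"
      using jump[of 0] jump[of "Suc (0)"] jump[of "Suc (Suc (0))"] jump[of "Suc (Suc (Suc (0)))"] jump[of "Suc (Suc (Suc (Suc (0))))"] jump[of "Suc (Suc (Suc (Suc (Suc (0)))))"] unfolding xs by simp_all
    show ?thesis using few many xy steps jumps unfolding xs by (auto split: if_splits)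
  qed
  moreover have "f x = f y" if len: "length xs = 7"
  proof -
    obtain x0 x1 x2 x3 x4 x5 x6 where xs: "xs = [x0, x1, x2, x3, x4, x5, x6]"
      using len by (auto simp: numeral_eq_Suc length_Suc_conv)
    have steps: "\<not> (Q x0 \<and> Q x1)" "\<not> (Q x1 \<and> Q x2)" "\<not> (Q x2 \<and> Q x3)" "\<not> (Q x3 \<and> Q x4)" "\<not> (Q x4 \<and> Q x5)" "\<not> (Q x5 \<and> Q x6)" "\<not> (Q x6 \<and> Q x0)"
      using step[of 0] step[of "Suc (0)"] step[of "Suc (Suc (0))"] step[of "Suc (Suc (Suc (0)))"] step[of "Suc (Suc (Suc (Suc (0))))"] step[of "Suc (Suc (Suc (Suc (Suc (0)))))"] step[of "Suc (Suc (Suc (Suc (Suc (Suc (0))))))"] unfolding xs by simp_all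
    have jumps: "Q x0 \<Longrightarrow> Q x2 \<Longrightarrow> f x0 = f x2" "Q x1 \<Longrightarrow> Q x3 \<Longrightarrow> f x1 = f x3" "Q x2 \<Longrightarrow> Q x4 \<Longrightarrow> f x2 = f x4" "Q x3 \<Longrightarrow> Q x5 \<Longrightarrow> f x3 = f x5" "Q x4 \<Longrightarrow> Q x6 \<Longrightarrow> f x4 = f x6" "Q x5 \<Longrightarrow> Q x0 \<Longrightarrow> f x5 = f x0" "Q x6 \<Longrightarrow> Q x1 \<Longrightarrow> f x6 = f x1"
      using jump[of 0] jump[of "Suc (0)"] jump[of "Suc (Suc (0))"] jump[of "Suc (Suc (Suc (0)))"] jump[of "Suc (Suc (Suc (Suc (0))))"] jump[of "Suc (Suc (Suc (Suc (Suc (0)))))"] jump[of "Suc (Suc (Suc (Suc (Suc (Suc (0))))))"] unfolding xs by simp_all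
    show ?thesis using few many xy steps jumps unfolding xs by (auto split: if_splits)
  qed
  moreover have "f x = f y" if len: "length xs = 8"
  proof -
    obtain x0 x1 x2 x3 x4 x5 x6 x7 where xs: "xs = [x0, x1, x2, x3, x4, x5, x6, x7]"
      using len by (auto simp: numeral_eq_Suc length_Suc_conv)
    have steps: "\<not> (Q x0 \<and> Q x1)" "\<not> (Q x1 \<and> Q x2)" "\<not> (Q x2 \<and> Q x3)" "\<not> (Q x3 \<and> Q x4)" "\<not> (Q x4 \<and> Q x5)" "\<not> (Q x5 \<and> Q x6)" "\<not> (Q x6 \<and> Q x7)" "\<not> (Q x7 \<and> Q x0)"
      using step[of 0] step[of "Suc (0)"] step[of "Suc (Suc (0))"] step[of "Suc (Suc (Suc (0)))"] step[of "Suc (Suc (Suc (Suc (0))))"] step[of "Suc (Suc (Suc (Suc (Suc (0)))))"] step[of "Suc (Suc (Suc (Suc (Suc (Suc (0))))))"] step[of "Suc (Suc (Suc (Suc (Suc (Suc (Suc (0)))))))"] unfolding xs by simp_all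
    have jumps: "Q x0 \<Longrightarrow> Q x2 \<Longrightarrow> f x0 = f x2" "Q x1 \<Longrightarrow> Q x3 \<Longrightarrow> f x1 = f x3" "Q x2 \<Longrightarrow> Q x4 \<Longrightarrow> f x2 = f x4" "Q x3 \<Longrightarrow> Q x5 \<Longrightarrow> f x3 = f x5" "Q x4 \<Longrightarrow> Q x6 \<Longrightarrow> f x4 = f x6" "Q x5 \<Longrightarrow> Q x7 \<Longrightarrow> f x5 = f x7" "Q x6 \<Longrightarrow> Q x0 \<Longrightarrow> f x6 = f x0" "Q x7 \<Longrightarrow> Q x1 \<Longrightarrow> f x7 = f x1"
      using jump[of 0] jump[of "Suc (0)"] jump[of "Suc (Suc (0))"] jump[of "Suc (Suc (Suc (0)))"] jump[of "Suc (Suc (Suc (Suc (0))))"] jump[of "Suc (Suc (Suc (Suc (Suc (0)))))"] jump[of "Suc (Suc (Suc (Suc (Suc (Suc (0))))))"] jump[of "Suc (Suc (Suc (Suc (Suc (Suc (Suc (0)))))))"] unfolding xs by simp_all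
    show ?thesis using few many xy steps jumps unfolding xs by (auto split: if_splits)
  qed
  moreover have False if len: "length xs = 9"
  proof -
    obtain x0 x1 x2 x3 x4 x5 x6 x7 x8 where xs: "xs = [x0, x1, x2, x3, x4, x5, x6, x7, x8]"
      using len by (auto simp: numeral_eq_Suc length_Suc_conv)
    have steps: "\<not> (Q x0 \<and> Q x1)" "\<not> (Q x1 \<and> Q x2)" "\<not> (Q x2 \<and> Q x3)" "\<not> (Q x3 \<and> Q x4)" "\<not> (Q x4 \<and> Q x5)" "\<not> (Q x5 \<and> Q x6)" "\<not> (Q x6 \<and> Q x7)" "\<not> (Q x7 \<and> Q x8)" "\<not> (Q x8 \<and> Q x0)"
      using step[of 0] step[of "Suc (0)"] step[of "Suc (Suc (0))"] step[of "Suc (Suc (Suc (0)))"] step[of "Suc (Suc (Suc (Suc (0))))"] step[of "Suc (Suc (Suc (Suc (Suc (0)))))"] step[of "Suc (Suc (Suc (Suc (Suc (Suc (0))))))"] step[of "Suc (Suc (Suc (Suc (Suc (Suc (Suc (0)))))))"] step[of "Suc (Suc (Suc (Suc (Suc (Suc (Suc (Suc (0))))))))"] unfolding xs by simp_all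
    show False using few many steps unfolding xs by (auto split: if_splits)
  qed
  ultimately show ?thesis by auto
qed
subsection \<open>Cycles\<close>

text \<open>The modular index becomes a path closed by repeating its head, so that rerouting a cycle
  is list concatenation.\<close>

lemma is_cycle_iff:
  "is_cycle V E vs \<longleftrightarrow> length vs \<ge> 3 \<and> distinct vs \<and> set vs \<subseteq> V \<and>
     successively (\<lambda>x y. {x, y} \<in> E) (vs @ [hd vs])"
proof (cases "length vs \<ge> 3")
  case True
  then have ne: "vs \<noteq> []" by auto
  have "(vs @ [hd vs]) ! Suc i = vs ! ((i + 1) mod length vs)" "(vs @ [hd vs]) ! i = vs ! i"
    if "i < length vs" for i
  proof -
    show "(vs @ [hd vs]) ! Suc i = vs ! ((i + 1) mod length vs)"
      using that ne by (cases "Suc i = length vs") (auto simp: nth_append hd_conv_nth)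
    show "(vs @ [hd vs]) ! i = vs ! i" using that by (simp add: nth_append)
  qed
  then show ?thesis by (auto simp: is_cycle_def successively_conv_nth)
qed (simp add: is_cycle_def)

lemma is_cycle_swap:
  assumes "is_cycle V E (xs @ ys)"
  shows "is_cycle V E (ys @ xs)"
proof (cases "xs = [] \<or> ys = []")
  case True
  then show ?thesis using assms by auto
next
  case False
  then show ?thesis using assms
    by (simp add: is_cycle_iff successively_append_iff Int_commute add.commute conj_ac)
qed

text \<open>Makes \<open>a\<close> the head, followed by its next two vertices; length and vertex
  set are kept so that maximality carries over.\<close>

lemma is_cycle_rotate:
  assumes "is_cycle V E C" "a \<in> set C"
  obtains b c rs where "is_cycle V E (a # b # c # rs)" "length (a # b # c # rs) = length C"
    "set (a # b # c # rs) = set C"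
proof -
  obtain us vs where C: "C = us @ a # vs" using assms(2) by (meson split_list)
  let ?D = "a # vs @ us"
  have D: "is_cycle V E ?D" "length ?D = length C" "set ?D = set C"
    using is_cycle_swap[of V E us "a # vs"] assms(1) C by auto
  then have "length ?D \<ge> 3" by (simp only: is_cycle_def)
  then obtain b c rs where "?D = a # b # c # rs"
    by (metis Suc_le_length_iff eval_nat_numeral(3) list.sel(3) numeral_2_eq_2)
  then show thesis using that D by metis
qed

lemma is_cycle_two_nbrs:
  assumes "is_cycle V E (a # b # c # rs)"
  shows "{a, b} \<in> E" "{a, last (c # rs)} \<in> E" "b \<noteq> last (c # rs)"
proof -
  have "{last (c # rs), a} \<in> E"
    using assms by (auto simp: is_cycle_iff successively_append_iff successively_Cons hd_append)
  then show "{a, last (c # rs)} \<in> E" by (metis insert_commute)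
  show "{a, b} \<in> E" using assms by (auto simp: is_cycle_iff)
  have "b \<notin> set (c # rs)" using assms by (auto simp: is_cycle_iff)
  then show "b \<noteq> last (c # rs)" using last_in_set[of "c # rs"] by auto
qed

lemma is_cycle_degree:
  assumes "is_cycle V E C" "a \<in> set C" "set C \<subseteq> S" "finite S"
  shows "2 \<le> card (nbrs E S a)"
proof -
  obtain b c rs where C: "is_cycle V E (a # b # c # rs)" "set (a # b # c # rs) = set C"
    using is_cycle_rotate[OF assms(1,2)] by metis
  have "last (c # rs) \<in> set (c # rs)" by (rule last_in_set) simp
  then have "last (c # rs) \<in> S" "b \<in> S"
    using C(2) assms(3) by (metis in_mono list.set_intros)+
  then have "{b, last (c # rs)} \<subseteq> nbrs E S a" using is_cycle_two_nbrs[OF C(1)] by (auto simp del: last.simps)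
  then have "card {b, last (c # rs)} \<le> card (nbrs E S a)"
    using assms(4) by (intro card_mono finite_nbrs)
  then show ?thesis using is_cycle_two_nbrs(3)[OF C(1)] by simp
qed

text \<open>A path through \<open>D\<close> from \<open>y\<close> to \<open>y'\<close>, inserted
  between \<open>a\<close> and \<open>b\<close>, gives a longer cycle; it has at least one vertex
  even when \<open>y = y'\<close>.\<close>

lemma longest_cycle_consecutive:
  assumes cyc: "is_cycle V E (a # b # rs)" and max: "\<And>C. is_cycle V E C \<Longrightarrow> length C \<le> length (a # b # rs)"
    and D: "induced_connected V E D" "D \<inter> set (a # b # rs) = {}"
    and y: "y \<in> D" "{a, y} \<in> E" "y' \<in> D" "{b, y'} \<in> E"
  shows False
proof -
  obtain ps where ps: "successively (\<lambda>x y. {x, y} \<in> E) ps" "distinct ps" "set ps \<subseteq> D"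
    "ps \<noteq> []" "hd ps = y" "last ps = y'" using induced_connected_obtain_path[OF D(1) y(1,3)] .
  have DV: "D \<subseteq> V" using D by (simp add: induced_connected_def)
  have "{y', b} \<in> E" using y by (simp add: insert_commute)
  then have "is_cycle V E (a # ps @ b # rs)"
    using cyc ps D(2) DV y unfolding is_cycle_iff
    by (auto simp: successively_append_iff successively_Cons hd_append)
  from max[OF this] show False using ps by simp
qed

text \<open>If \<open>y \<noteq> y'\<close>, a path through \<open>D\<close> has at least two
  vertices, so putting it in place of \<open>b\<close> lengthens the cycle.\<close>

lemma longest_cycle_distance_two:
  assumes cyc: "is_cycle V E (a # b # c # rs)"
    and max: "\<And>C. is_cycle V E C \<Longrightarrow> length C \<le> length (a # b # c # rs)"
    and D: "induced_connected V E D" "D \<inter> set (a # b # c # rs) = {}"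
    and y: "y \<in> D" "{a, y} \<in> E" "y' \<in> D" "{c, y'} \<in> E"
  shows "y = y'"
proof (rule ccontr)
  assume ne: "y \<noteq> y'"
  obtain ps where ps: "successively (\<lambda>x y. {x, y} \<in> E) ps" "distinct ps" "set ps \<subseteq> D"
    "ps \<noteq> []" "hd ps = y" "last ps = y'" using induced_connected_obtain_path[OF D(1) y(1,3)] .
  have DV: "D \<subseteq> V" using D by (simp add: induced_connected_def)
  obtain p q qs where pq: "ps = p # q # qs" using ps ne by (metis hd_Cons_tl last.simps list.sel(1))
  have "{y', c} \<in> E" using y by (simp add: insert_commute)
  then have "is_cycle V E (a # ps @ c # rs)"
    using cyc ps D(2) DV y unfolding is_cycle_iff
    by (auto simp: successively_append_iff successively_Cons hd_append pq)
  from max[OF this] show False using pq by simp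
qed

lemma card_nbrs_split:
  assumes "finite V" "S \<subseteq> V"
  shows "card (nbrs E S x) + card (nbrs E (V - S) x) = card (nbrs E V x)"
proof -
  have "nbrs E V x = nbrs E S x \<union> nbrs E (V - S) x" using assms by auto
  moreover have "nbrs E S x \<inter> nbrs E (V - S) x = {}" by auto
  moreover have "finite (nbrs E S x)" "finite (nbrs E (V - S) x)"
    using assms by (auto intro: finite_nbrs finite_subset)
  ultimately show ?thesis by (simp add: card_Un_disjoint)
qed

subsection \<open>A longest cycle missing a largest bond\<close>

text \<open>A hypothetical counterexample, with \<open>Y\<close> the side of the bond that the cycle
  avoids. The sets \<open>Z\<close> in \<open>largest\<close> have both sides connected, so their
  cuts are bonds.\<close>

locale longest_cycle_off_largest_bond =
  fixes V :: "'a set" and E :: "'a set set" and C :: "'a list" and Y :: "'a set"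
  assumes graph: "graph V E"
    and k_connected: "k_connected 3 V E"
    and cycle: "is_cycle V E C"
    and longest: "is_cycle V E C' \<Longrightarrow> length C' \<le> length C"
    and Y_subset: "Y \<subseteq> V"
    and Y_nonempty: "Y \<noteq> {}"
    and Y_connected: "induced_connected V E Y"
    and compl_connected: "induced_connected V E (V - Y)"
    and Y_disjoint: "Y \<inter> set C = {}"
    and largest: "\<lbrakk>Z \<subseteq> V; Z \<noteq> {}; V - Z \<noteq> {}; induced_connected V E Z; induced_connected V E (V - Z)\<rbrakk>
      \<Longrightarrow> card (edge_cut V E Z) \<le> card (edge_cut V E Y)"
begin

lemma finite_V: "finite V" and finite_E: "finite E"
  using graph_finite[OF graph] by auto

lemma finite_Y: "finite Y"
  using finite_V Y_subset finite_subset by auto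

lemma C_subset: "set C \<subseteq> V - Y"
  using cycle Y_disjoint by (auto simp: is_cycle_def)

lemma degree: "v \<in> V \<Longrightarrow> 3 \<le> card (nbrs E V v)"
  using k_connected_degree[OF graph k_connected] .

lemma nbrs_split: "S \<subseteq> V \<Longrightarrow> card (nbrs E S x) + card (nbrs E (V - S) x) = card (nbrs E V x)"
  using card_nbrs_split[OF finite_V] .

lemma edge_commute: "{x, y} \<in> E \<longleftrightarrow> {y, x} \<in> E"
  by (simp add: insert_commute)

text \<open>If \<open>Y = {y}\<close>, moving a neighbour \<open>v\<close> of \<open>y\<close> loses
  one cut edge and gains at least two, and deleting two vertices leaves the other side
  connected.\<close>

lemma two_le_card_Y: "2 \<le> card Y"
proof (rule ccontr)
  assume "\<not> ?thesis"
  moreover have "card Y > 0" using Y_nonempty finite_Y by (simp add: card_gt_0_iff)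
  ultimately have "card Y = 1" by simp
  then obtain y where y: "Y = {y}" using card_1_singletonE by blast
  then have "nbrs E V y \<noteq> {}" using degree[of y] Y_subset by auto
  then obtain v where v: "v \<in> V" "{y, v} \<in> E" by (meson all_not_in_conv nbrs_iff)
  have vy: "v \<noteq> y" using v graph_no_loop[OF graph] by auto
  let ?Z = "insert v Y"
  have c: "card ?Z = 2" using y vy by simp
  have Z: "?Z \<subseteq> V" "?Z \<noteq> {}" using v Y_subset by auto
  have "card V \<ge> 4" using k_connected by (simp add: k_connected_def)
  then have "?Z \<noteq> V" using c by auto
  then have ne: "V - ?Z \<noteq> {}" using Z by auto
  have "induced_connected V E (V - ?Z)" using k_connected Z c by (simp add: k_connected_def)
  moreover have "induced_connected V E ?Z"
    using induced_connected_insert[OF Y_connected, of y v] y v edge_commute[of y v] by auto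
  ultimately have "card (edge_cut V E ?Z) \<le> card (edge_cut V E Y)" using largest Z ne by blast
  moreover have "card (edge_cut V E ?Z) + card (nbrs E Y v) =
      card (edge_cut V E Y) + card (nbrs E (V - Y) v)"
    using card_edge_cut_insert[OF graph Y_subset, of v] v vy y by simp
  moreover have "card (nbrs E Y v) \<le> 1"
    using card_mono[of Y "nbrs E Y v"] y by (auto simp: nbrs_def)
  moreover have "card (nbrs E Y v) + card (nbrs E (V - Y) v) \<ge> 3"
    using nbrs_split[OF Y_subset] degree v by simp
  ultimately show False by linarith
qed

lemma consecutive:
  assumes "is_cycle V E (a # b # rs)" "length (a # b # rs) = length C" "set (a # b # rs) = set C"
    "induced_connected V E D" "D \<inter> set C = {}" "y \<in> D" "{a, y} \<in> E" "y' \<in> D" "{b, y'} \<in> E"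
  shows False
  using longest_cycle_consecutive[OF assms(1) _ assms(4) _ assms(6-9)] assms(2,3,5) longest by metis

lemma distance_two:
  assumes "is_cycle V E (a # b # c # rs)" "length (a # b # c # rs) = length C"
    "set (a # b # c # rs) = set C"
    "induced_connected V E D" "D \<inter> set C = {}" "y \<in> D" "{a, y} \<in> E" "y' \<in> D" "{c, y'} \<in> E"
  shows "y = y'"
  using longest_cycle_distance_two[OF assms(1) _ assms(4) _ assms(6-9)] assms(2,3,5) longest by metis

text \<open>Compares the bond around \<open>Y\<close> with the one obtained by moving two consecutive vertices
  of the cycle to the side of \<open>Y\<close>.\<close>

lemma move_two:
  assumes C': "is_cycle V E (a # b # c # rs)" "length (a # b # c # rs) = length C"
      "set (a # b # c # rs) = set C"
    and y: "y \<in> Y" "{a, y} \<in> E"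
    and con: "induced_connected V E (V - Y - {a, b})"
  shows "card (edge_cut V E (insert b (insert a Y))) + card (nbrs E Y a) + 2 =
      card (edge_cut V E Y) + card (nbrs E (V - Y) a) + card (nbrs E V b)"
    and "card (nbrs E (V - Y) a) + card (nbrs E V b) \<le> card (nbrs E Y a) + 2"
    and "3 \<le> card (nbrs E Y a)"
    and "induced_connected V E (insert b (insert a Y))"
proof -
  have abc: "a \<in> V - Y" "b \<in> V - Y" "c \<in> V - Y" using C_subset C'(3) by auto
  have dist: "a \<noteq> b" "c \<noteq> a" "c \<noteq> b" using C'(1) by (auto simp: is_cycle_def)
  have ab: "{a, b} \<in> E" using is_cycle_two_nbrs[OF C'(1)] by simp
  \<comment> \<open>As the successor of an attached vertex, \<open>b\<close> has no neighbour in
    \<open>Y\<close> and meets the enlarged side only in \<open>a\<close>.\<close>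
  have "{b, y'} \<notin> E" if "y' \<in> Y" for y'
    using consecutive[OF C' Y_connected Y_disjoint y that] by blast
  then have nb: "nbrs E (insert a Y) b = {a}" using ab edge_commute[of a b] by auto
  have e1: "card (edge_cut V E (insert a Y)) + card (nbrs E Y a) =
      card (edge_cut V E Y) + card (nbrs E (V - Y) a)"
    using card_edge_cut_insert[OF graph Y_subset abc(1)] .
  have sub: "insert a Y \<subseteq> V" using abc Y_subset by auto
  have e2: "card (edge_cut V E (insert b (insert a Y))) + 1 =
      card (edge_cut V E (insert a Y)) + card (nbrs E (V - insert a Y) b)"
    using card_edge_cut_insert[OF graph sub, of b] abc dist nb by simp
  have e3: "1 + card (nbrs E (V - insert a Y) b) = card (nbrs E V b)"
    using nbrs_split[OF sub, of b] nb by simp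
  show eq: "card (edge_cut V E (insert b (insert a Y))) + card (nbrs E Y a) + 2 =
      card (edge_cut V E Y) + card (nbrs E (V - Y) a) + card (nbrs E V b)"
    using e1 e2 e3 by linarith
  have "induced_connected V E (insert a Y)"
    using induced_connected_insert[OF Y_connected y] abc by simp
  then show conZ: "induced_connected V E (insert b (insert a Y))"
    using induced_connected_insert[of V E "insert a Y" a b] ab edge_commute[of a b] abc by auto
  have "V - insert b (insert a Y) = V - Y - {a, b}" by auto
  then have "card (edge_cut V E (insert b (insert a Y))) \<le> card (edge_cut V E Y)"
    using largest[of "insert b (insert a Y)"] conZ con sub abc dist by auto
  then show le: "card (nbrs E (V - Y) a) + card (nbrs E V b) \<le> card (nbrs E Y a) + 2"
    using eq by linarith
  \<comment> \<open>Both cycle neighbours of \<open>a\<close> lie off \<open>Y\<close> and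
    \<open>b\<close> has degree at least 3, so
    \<open>2 + 3 \<le> card (nbrs E Y a) + 2\<close>.\<close>
  have "2 \<le> card (nbrs E (V - Y) a)"
    using is_cycle_degree[OF cycle _ C_subset] C'(3) finite_V by auto
  then show "3 \<le> card (nbrs E Y a)" using le degree[of b] abc by simp
qed

text \<open>3-connectivity as used below; \<open>w\<close> witnesses that something lies beyond
  \<open>D\<close> after deleting \<open>S\<close>.\<close>

lemma separation:
  assumes "S \<subseteq> V" "card S < 3" "D \<subseteq> V - S" "D \<noteq> {}" "w \<in> V - S - D"
  shows "\<exists>t\<in>D. \<exists>s\<in>V - S - D. {t, s} \<in> E"
proof -
  have "D \<noteq> V - S" using assms(5) by auto
  then show ?thesis using k_connected_edge[OF k_connected assms(1-4)] by metis
qed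

section \<open>At most three vertices off the cycle\<close>

text \<open>Moving an attached \<open>a\<close> and its successor \<open>b\<close> leaves a path, so
  \<open>move_two\<close> applies and all its estimates are tight. Moving the next vertex
  \<open>c\<close> as well then strictly enlarges the bond.\<close>

lemma compl_ne_cycle:
  assumes "card Y \<le> 3" shows "V - Y \<noteq> set C"
proof
  assume X: "V - Y = set C"
  have "set C \<noteq> {}" using cycle by (auto simp: is_cycle_def)
  then obtain w where "w \<in> V - {} - Y" using X by (metis Diff_empty all_not_in_conv)
  \<comment> \<open>Deleting nothing, connectivity alone yields an attached vertex
    \<open>a\<close>.\<close>
  then have "\<exists>y\<in>Y. \<exists>a\<in>V - {} - Y. {y, a} \<in> E"
    by (intro separation[where w = w]) (use Y_nonempty Y_subset in auto)
  then obtain y a where ya: "y \<in> Y" "a \<in> set C" "{y, a} \<in> E" using X by auto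
  have ay: "{a, y} \<in> E" using ya edge_commute[of y a] by simp
  obtain b c rs where C': "is_cycle V E (a # b # c # rs)" "length (a # b # c # rs) = length C"
    "set (a # b # c # rs) = set C" using is_cycle_rotate[OF cycle ya(2)] .
  have dist: "distinct (a # b # c # rs)" using C'(1) by (simp only: is_cycle_def)
  have X': "V - Y - {a, b} = set (c # rs)" "V - Y - {a, b, c} = set rs"
    using X C'(3) dist by auto
  have path: "successively (\<lambda>x y. {x, y} \<in> E) (c # rs)" "successively (\<lambda>x y. {x, y} \<in> E) rs" "{b, c} \<in> E"
    using C'(1) by (auto simp: is_cycle_iff successively_append_iff successively_Cons hd_append split: if_splits)
  have subV: "set (c # rs) \<subseteq> V" using X' by auto
  have con: "induced_connected V E (V - Y - {a, b})"
    using induced_connected_path[OF path(1) subV] X' by simp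
  note mv = move_two[OF C' ya(1) ay con]
  have NY: "card (nbrs E Y a) \<le> card Y" by (rule card_mono[OF finite_Y]) auto
  have abc: "a \<in> V - Y" "b \<in> V - Y" "c \<in> V - Y" using X C'(3) by auto
  have "2 \<le> card (nbrs E (V - Y) a)"
    using is_cycle_degree[OF cycle ya(2) C_subset] finite_V by auto
  \<comment> \<open>\<open>a\<close> has at least 3 neighbours in \<open>Y\<close>, which has at
    most 3 vertices; the lower bounds 2 and 3 then meet the upper bound \<open>3 + 2\<close> on
    their sum.\<close>
  then have cards: "card (nbrs E Y a) = 3" "card (nbrs E (V - Y) a) = 2" "card (nbrs E V b) = 3"
    using mv(2,3) NY assms degree[of b] abc by auto
  \<comment> \<open>\<open>c\<close> is at distance two from \<open>a\<close>, so an attached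
    \<open>c\<close> would leave \<open>a\<close> with a single neighbour in
    \<open>Y\<close>.\<close>
  have nc: "{c, y'} \<notin> E" if "y' \<in> Y" for y'
  proof
    assume y': "{c, y'} \<in> E"
    have "nbrs E Y a \<subseteq> {y'}"
      using distance_two[OF C' Y_connected Y_disjoint _ _ that y'] by auto
    then have "card (nbrs E Y a) \<le> 1" using card_mono[of "{y'}"] by fastforce
    then show False using cards by simp
  qed
  \<comment> \<open>Deleting \<open>a\<close> and \<open>b\<close> leaves another attached vertex
    \<open>s\<close>. It lies in \<open>rs\<close>, so something remains once \<open>c\<close> has
    moved too.\<close>
  have "card {a, b} < 3" by (simp add: card_insert_if)
  moreover have "c \<in> V - {a, b} - Y" using abc dist by auto
  ultimately have "\<exists>t\<in>Y. \<exists>s\<in>V - {a, b} - Y. {t, s} \<in> E"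
    by (intro separation[where w = c]) (use abc Y_subset Y_nonempty in auto)
  then obtain t s where ts: "t \<in> Y" "s \<in> V - {a, b} - Y" "{t, s} \<in> E" by blast
  have "s \<noteq> c" using nc[OF ts(1)] ts(3) edge_commute by auto
  then have s: "s \<in> set rs" using ts X' by auto
  \<comment> \<open>The chord would give \<open>a\<close> a third neighbour off \<open>Y\<close>,
    besides its two cycle neighbours.\<close>
  have ca: "{c, a} \<notin> E"
  proof
    assume "{c, a} \<in> E"
    then have "{b, last rs, c} \<subseteq> nbrs E (V - Y) a"
      using is_cycle_two_nbrs[OF C'(1)] s abc X C'(3) last_in_set[of rs] edge_commute[of a c] by (auto split: if_splits)
    then have "card {b, last rs, c} \<le> 2"
      using card_mono[of "nbrs E (V - Y) a"] cards finite_nbrs[of "V - Y"] finite_V by (metis finite_Diff)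
    moreover have "last rs \<in> set rs" using s by (cases rs) auto
    then have "b \<noteq> last rs" "c \<noteq> last rs" "b \<noteq> c" using dist by auto
    then have "card {b, last rs, c} = 3" by auto
    ultimately show False by simp
  qed
  let ?Z = "insert b (insert a Y)"
  have nbc: "nbrs E ?Z c = {b}" using nc ca path(3) edge_commute[of b c] by auto
  have sub: "?Z \<subseteq> V" using abc Y_subset by auto
  have "card (edge_cut V E (insert c ?Z)) + 1 = card (edge_cut V E ?Z) + card (nbrs E (V - ?Z) c)"
    using card_edge_cut_insert[OF graph sub, of c] abc dist nbc by auto
  moreover have "1 + card (nbrs E (V - ?Z) c) = card (nbrs E V c)"
    using nbrs_split[OF sub, of c] nbc by simp
  \<comment> \<open>Moving \<open>a\<close> and \<open>b\<close> kept the size of the cut;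
    \<open>c\<close> has one neighbour on the new side, so moving it adds
    \<open>deg c - 2 \<ge> 1\<close>.\<close>
  ultimately have "card (edge_cut V E (insert c ?Z)) > card (edge_cut V E Y)"
    using mv(1) cards degree[of c] abc by simp
  moreover have "card (edge_cut V E (insert c ?Z)) \<le> card (edge_cut V E Y)"
  proof (rule largest)
    have eq: "V - insert c ?Z = set rs" using X'(2) by auto
    show "insert c ?Z \<subseteq> V" "insert c ?Z \<noteq> {}" using sub abc by auto
    show "V - insert c ?Z \<noteq> {}" unfolding eq using s by auto
    show "induced_connected V E (V - insert c ?Z)"
      unfolding eq using induced_connected_path[OF path(2)] subV by auto
    show "induced_connected V E (insert c ?Z)"
      using induced_connected_insert[OF mv(4), of b c] path(3) edge_commute[of b c] abc by auto
  qed
  ultimately show False by simp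
qed

text \<open>With only two vertices in \<open>Y\<close>, \<open>move_two\<close> must fail, so
  removing an attached vertex and its successor disconnects \<open>z\<close> from the remaining
  path. Hence \<open>z\<close> has all its cycle neighbours in that pair, and two disjoint such
  pairs are contradictory.\<close>

lemma compl_ne_insert_cycle:
  assumes cY: "card Y = 2" and z: "z \<notin> set C" shows "V - Y \<noteq> insert z (set C)"
proof
  assume X: "V - Y = insert z (set C)"
  have zV: "z \<in> V" "z \<notin> Y" using X by auto
  have zN: "s \<in> {a, b}"
    if C': "is_cycle V E (a # b # c # rs)" "length (a # b # c # rs) = length C"
      "set (a # b # c # rs) = set C" and y: "y \<in> Y" "{a, y} \<in> E" and s: "s \<in> set C" "{z, s} \<in> E"
    for a b c rs y s
  proof (rule ccontr)
    assume n: "s \<notin> {a, b}"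
    have dist: "distinct (a # b # c # rs)" using C'(1) by (simp only: is_cycle_def)
    have path: "successively (\<lambda>x y. {x, y} \<in> E) (c # rs)"
      using C'(1) by (auto simp: is_cycle_iff successively_append_iff successively_Cons hd_append split: if_splits)
    have "set (c # rs) \<subseteq> V" using X C'(3) by auto
    from induced_connected_path[OF path this]
    have "induced_connected V E (insert z (set (c # rs)))"
      using induced_connected_insert[of V E "set (c # rs)" s z] s n C'(3) zV by auto
    moreover have "V - Y - {a, b} = insert z (set (c # rs))"
      using X C'(3) dist z by auto
    ultimately have "3 \<le> card (nbrs E Y a)" using move_two(3)[OF C' y] by simp
    moreover have "card (nbrs E Y a) \<le> card Y" by (rule card_mono[OF finite_Y]) auto
    ultimately show False using cY by simp
  qed
  have "set C \<noteq> {}" using cycle by (auto simp: is_cycle_def)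
  then obtain w where "w \<in> set C" by (meson all_not_in_conv)
  then have "w \<in> V - {z} - Y" using X z by auto
  \<comment> \<open>Deleting \<open>z\<close> forces the attached vertex onto the cycle.\<close>
  then have "\<exists>y\<in>Y. \<exists>a\<in>V - {z} - Y. {y, a} \<in> E"
    by (intro separation[where w = w]) (use Y_nonempty Y_subset zV in auto)
  then obtain y a where ya: "y \<in> Y" "a \<in> V - {z} - Y" "{y, a} \<in> E" by blast
  have a: "a \<in> set C" "{a, y} \<in> E" using ya X edge_commute[of y a] by auto
  obtain b c rs where C': "is_cycle V E (a # b # c # rs)" "length (a # b # c # rs) = length C"
    "set (a # b # c # rs) = set C" using is_cycle_rotate[OF cycle a(1)] .
  have dist: "distinct (a # b # c # rs)" using C'(1) by (simp only: is_cycle_def)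
  have abc: "a \<in> V - Y" "b \<in> V - Y" "c \<in> V - Y" using X C'(3) by auto
  have abcz: "z \<noteq> a" "z \<noteq> b" "z \<noteq> c" using z C'(3) by auto
  have "card {a, b} < 3" by (simp add: card_insert_if)
  \<comment> \<open>After deleting \<open>a\<close> and \<open>b\<close>, some edge still leaves
    \<open>insert z Y\<close>. By \<open>zN\<close> it does not start at \<open>z\<close>, so it
    yields a second attached vertex \<open>s\<close>.\<close>
  moreover have "c \<in> V - {a, b} - insert z Y" using abc dist abcz by auto
  ultimately have "\<exists>t\<in>insert z Y. \<exists>s\<in>V - {a, b} - insert z Y. {t, s} \<in> E"
    by (intro separation[where w = c]) (use abc Y_subset zV abcz in auto)
  then obtain t s where ts: "t \<in> insert z Y" "s \<in> V - {a, b} - insert z Y" "{t, s} \<in> E" by blast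
  have s: "s \<in> set C" "s \<notin> {a, b}" using ts X by auto
  have "t \<noteq> z" using zN[OF C' ya(1) a(2) s(1)] s(2) ts(3) by auto
  then have t: "t \<in> Y" "{s, t} \<in> E" using ts edge_commute[of s t] by auto
  have "s \<in> set (c # rs)" using s C'(3) by auto
  then obtain us vs where uv: "c # rs = us @ s # vs" by (meson split_list)
  have D: "is_cycle V E (s # vs @ a # b # us)"
    using is_cycle_swap[of V E "a # b # us" "s # vs"] C'(1) uv by simp
  have l: "length (s # vs @ a # b # us) = length C" "set (s # vs @ a # b # us) = set C"
    using C'(2,3) arg_cong[OF uv, of length] arg_cong[OF uv, of set] by auto
  \<comment> \<open>If nothing follows \<open>s\<close>, it precedes \<open>a\<close>, against
    \<open>consecutive\<close>. Otherwise its successor \<open>v\<close> lies in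
    \<open>c # rs\<close>, so \<open>{s, v}\<close> and \<open>{a, b}\<close> are disjoint.\<close>
  show False
  proof (cases vs)
    case Nil
    then show False
      using consecutive[of s a "b # us" Y t y] D l Y_connected Y_disjoint t ya(1) a(2) by simp
  next
    case (Cons v vs')
    obtain c' rs' where cr: "vs' @ a # b # us = c' # rs'" by (cases vs') auto
    have D': "is_cycle V E (s # v # c' # rs')" "length (s # v # c' # rs') = length C"
      "set (s # v # c' # rs') = set C" using D l Cons cr by auto
    \<comment> \<open>\<open>V - Y\<close> is connected, so \<open>z\<close> has a neighbour on the
      cycle; by \<open>zN\<close> it lies in both pairs.\<close>
    have "{z} \<subseteq> V - Y" "{z} \<noteq> {}" "{z} \<noteq> V - Y" using zV abc abcz by auto
    then obtain x where x: "x \<in> V - Y - {z}" "{z, x} \<in> E"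
      using induced_connected_edge[OF compl_connected, of "{z}"] by blast
    then have "x \<in> set C" using X by auto
    then have "x \<in> {a, b}" "x \<in> {s, v}" using zN[OF C' ya(1) a(2)] zN[OF D' t] x by auto
    moreover have "v \<in> set (c # rs)" using uv Cons by auto
    ultimately show False using dist s by auto
  qed
qed

text \<open>Of at most three vertices off the cycle at least two are in \<open>Y\<close>, so at most
  one is left over; the two preceding lemmas exclude both possibilities.\<close>

lemma four_le_card_off_cycle: "length C + 4 \<le> card V"
proof (rule ccontr)
  assume "\<not> ?thesis"
  moreover have "card (set C) = length C" using cycle by (simp add: is_cycle_def distinct_card)
  moreover have "card (V - set C) = card V - card (set C)"
    using C_subset by (intro card_Diff_subset) auto
  ultimately have c3: "card (V - set C) \<le> 3" by simp
  have fin: "finite (V - set C)" using finite_V by simp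
  have sub: "Y \<subseteq> V - set C" using Y_subset Y_disjoint by auto
  have c: "card (V - set C - Y) = card (V - set C) - card Y"
    using sub finite_Y by (intro card_Diff_subset)
  have cY: "card Y \<le> 3" using card_mono[OF fin sub] c3 by simp
  show False
  proof (cases "V - set C - Y = {}")
    case True
    then have "V - Y = set C" using sub C_subset by auto
    then show False using compl_ne_cycle cY by simp
  next
    case False
    then have "card (V - set C - Y) > 0" using fin by (simp add: card_gt_0_iff)
    then have "card (V - set C - Y) = 1" "card Y = 2" using c c3 two_le_card_Y by auto
    moreover from this(1) obtain z where "V - set C - Y = {z}" using card_1_singletonE by blast
    moreover then have "V - Y = insert z (set C)" "z \<notin> set C" using C_subset by auto
    ultimately show False using compl_ne_insert_cycle by blast
  qed
qed

section \<open>Bonds containing almost all edges\<close>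

text \<open>By \<open>cyclic_alternating\<close> all attached vertices share one and the same
  neighbour \<open>u\<close> in \<open>D\<close>. If \<open>D\<close> had further vertices,
  \<open>u\<close> would be a cut vertex.\<close>

lemma separated_off_cycle:
  assumes D: "induced_connected V E D" "D \<inter> set C = {}"
    and closed: "\<And>d v. d \<in> D \<Longrightarrow> v \<in> V - D - set C \<Longrightarrow> {d, v} \<notin> E"
    and few: "card {v \<in> set C. nbrs E D v = {}} \<le> 4"
  shows "card D \<le> 1"
proof (rule ccontr)
  assume nD: "\<not> card D \<le> 1"
  then have ne: "D \<noteq> {}" by auto
  have DV: "D \<subseteq> V" using D(1) by (simp add: induced_connected_def)
  have CV: "set C \<subseteq> V" and dist: "distinct C" and len: "3 \<le> length C"
    using cycle by (auto simp: is_cycle_def)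
  define Q where "Q v \<longleftrightarrow> nbrs E D v \<noteq> {}" for v
  define A where "A = {v \<in> set C. Q v}"
  have to_A: "s \<in> A" if "t \<in> D" "s \<in> V - D" "{t, s} \<in> E" for t s
  proof -
    have "s \<in> set C" using closed[of t s] that by auto
    moreover have "t \<in> nbrs E D s" using that edge_commute[of t s] by simp
    ultimately show ?thesis by (auto simp: A_def Q_def)
  qed
  \<comment> \<open>Fewer than three attached vertices would separate \<open>D\<close> from a
    remaining vertex of the cycle.\<close>
  have A3: "3 \<le> card A"
  proof (rule ccontr)
    assume "\<not> 3 \<le> card A"
    then have lt: "card A < 3" by simp
    then have "A \<noteq> set C" using len distinct_card[OF dist] by auto
    then obtain w where "w \<in> set C" "w \<notin> A" by (auto simp: A_def)
    then have w: "w \<in> V - A - D" using CV D(2) by auto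
    have "A \<subseteq> V" "D \<subseteq> V - A" using CV DV D(2) by (auto simp: A_def)
    then have "\<exists>t\<in>D. \<exists>s\<in>V - A - D. {t, s} \<in> E"
      using separation[OF _ lt _ ne w] by simp
    then show False using to_A by blast
  qed
  have card_filter: "length (filter P C) = card {v \<in> set C. P v}" for P
    using distinct_card[OF distinct_filter[OF dist, of P]] by simp
  have rot: "is_cycle V E (rotate i C)" for i
    unfolding rotate_drop_take using is_cycle_swap[of V E "take (i mod length C) C"] cycle by simp
  have rot': "length (rotate i C) = length C" "set (rotate i C) = set C" for i by auto
  \<comment> \<open>Every choice of neighbours is constant, so the neighbourhoods of two distinct attached
    vertices are the same singleton.\<close>
  have choice: "f x = f y"
    if f: "\<And>v. Q v \<Longrightarrow> f v \<in> nbrs E D v" and xy: "x \<in> A" "y \<in> A" for f x y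
  proof (rule cyclic_alternating[of C Q f])
    fix i a b rs assume "rotate i C = a # b # rs"
    then show "\<not> (Q a \<and> Q b)"
      using consecutive[of a b rs D] rot[of i] rot'[of i] D by (auto simp: Q_def)
  next
    fix i a b c rs assume r: "rotate i C = a # b # c # rs" and q: "Q a" "Q c"
    show "f a = f c"
      by (rule distance_two[of a b c rs D]) (use r rot[of i] rot'[of i] D f[OF q(1)] f[OF q(2)] in auto)
  next
    show "length (filter (\<lambda>x. \<not> Q x) C) \<le> 4" using few unfolding card_filter by (simp add: Q_def)
    show "3 \<le> length (filter Q C)" using A3 unfolding card_filter by (simp add: A_def)
  qed (use xy in \<open>auto simp: A_def\<close>)
  have unique: "u = v" if "x \<in> A" "y \<in> A" "x \<noteq> y" "u \<in> nbrs E D x" "v \<in> nbrs E D y" for x y u v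
  proof -
    \<comment> \<open>An arbitrary choice of neighbours, overridden at \<open>x\<close> and
      \<open>y\<close> so that any two given neighbours can be compared.\<close>
    define f where "f = (\<lambda>w. SOME z. z \<in> nbrs E D w)(x := u, y := v)"
    have "f w \<in> nbrs E D w" if "Q w" for w
      using that some_in_eq[of "nbrs E D w"] \<open>u \<in> nbrs E D x\<close> \<open>v \<in> nbrs E D y\<close>
      unfolding f_def Q_def by (simp del: nbrs_iff)
    then have "f x = f y" using choice that(1,2) by blast
    then show ?thesis using that(3) by (simp add: f_def)
  qed
  obtain x where x: "x \<in> A" using A3 by fastforce
  obtain y where y: "y \<in> A" "y \<noteq> x"
  proof -
    have "\<not> A \<subseteq> {x}" using A3 card_mono[of "{x}" A] by auto
    then show thesis using that by auto
  qed
  have "nbrs E D x \<noteq> {}" using x by (simp add: A_def Q_def)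
  then obtain u where u: "u \<in> nbrs E D x" by (meson all_not_in_conv)
  have "nbrs E D y \<noteq> {}" using y by (simp add: A_def Q_def)
  then obtain v where v: "v \<in> nbrs E D y" by (meson all_not_in_conv)
  have uniq: "t = u" if "t \<in> nbrs E D s" "s \<in> A" for t s
    using unique[OF that(2) x _ that(1) u] unique[OF that(2) y(1) _ that(1) v]
      unique[OF x y(1) y(2)[symmetric] u v] y(2) by blast
  have "D - {u} \<noteq> {}"
  proof
    assume "D - {u} = {}"
    then have "D \<subseteq> {u}" by auto
    then have "card D \<le> 1" using card_mono[of "{u}" D] by simp
    then show False using nD by simp
  qed
  moreover have "x \<in> V - {u} - (D - {u})" using x u CV D(2) by (auto simp: A_def)
  ultimately have "\<exists>t\<in>D - {u}. \<exists>s\<in>V - {u} - (D - {u}). {t, s} \<in> E"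
    using u DV by (intro separation[where w = x]) auto
  then obtain t s where ts: "t \<in> D" "t \<noteq> u" "s \<in> V - D" "{t, s} \<in> E" using u by auto
  have "s \<in> A" using to_A[OF ts(1,3,4)] .
  then show False using uniq[of t s] ts edge_commute[of t s] by auto
qed

text \<open>Otherwise at most \<open>card V + 1\<close> edges lie off the bond. Connectivity of the
  two sides puts at least \<open>card D - 1\<close> of them at vertices of \<open>D\<close>, leaving
  at most \<open>card H + 2\<close> inside \<open>H\<close>; the degrees in \<open>H\<close> then
  leave few unattached vertices, and \<open>separated_off_cycle\<close> contradicts
  \<open>2 \<le> card Y\<close>.\<close>

lemma many_edges_off_cut: "card (edge_cut V E Y) + card V + 1 < card E"
proof (rule ccontr)
  assume "\<not> ?thesis"
  then have E_le: "card E \<le> card (edge_cut V E Y) + card V + 1" by simp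
  \<comment> \<open>A maximal member is the component of the graph minus the cycle that contains
    \<open>Y\<close>.\<close>
  define \<S> where "\<S> = {S. Y \<subseteq> S \<and> S \<subseteq> V - set C \<and> induced_connected V E S}"
  have "\<S> \<subseteq> Pow V" by (auto simp: \<S>_def)
  then have "finite \<S>" using finite_V by (meson finite_Pow_iff finite_subset)
  moreover have "Y \<in> \<S>" using Y_subset Y_disjoint Y_connected by (auto simp: \<S>_def)
  ultimately have "\<exists>D\<in>\<S>. Y \<subseteq> D \<and> (\<forall>S\<in>\<S>. D \<subseteq> S \<longrightarrow> D = S)"
    by (rule finite_has_maximal2)
  then obtain D where D: "D \<in> \<S>" and D_max: "\<forall>S\<in>\<S>. D \<subseteq> S \<longrightarrow> D = S"
    by metis
  from D have YD: "Y \<subseteq> D" and DV: "D \<subseteq> V - set C" and D_con: "induced_connected V E D"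
    by (simp_all add: \<S>_def)
  have closed: "{d, v} \<notin> E" if "d \<in> D" "v \<in> V - D - set C" for d v
  proof
    assume "{d, v} \<in> E"
    then have "induced_connected V E (insert v D)"
      using induced_connected_insert[OF D_con that(1), of v] that(2) edge_commute[of v d] by auto
    then have "D = insert v D" using that(2) YD DV
        \<open>induced_connected V E (insert v D)\<close>
      by (intro D_max[rule_format]) (auto simp: \<S>_def)
    then show False using that(2) by auto
  qed
  define H where "H = V - D"
  define A where "A = {v \<in> set C. nbrs E D v \<noteq> {}}"
  have CH: "set C \<subseteq> H" using C_subset DV by (auto simp: H_def)
  have finH: "finite H" using finite_V by (simp add: H_def)
  have AH: "A \<subseteq> H" using CH by (auto simp: A_def)
  have finA: "finite A" by (simp add: A_def)
  \<comment> \<open>A vertex of \<open>H\<close> outside \<open>A\<close> has no neighbour in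
    \<open>D\<close>: on the cycle it is unattached, off the cycle it is in another component. So it
    keeps its full degree.\<close>
  have nonA: "3 \<le> card (nbrs E H h)" if h: "h \<in> H - A" for h
  proof -
    have "nbrs E D h = {}"
    proof (cases "h \<in> set C")
      case True
      then show ?thesis using h by (auto simp: A_def)
    next
      case False
      then have "{d, h} \<notin> E" if "d \<in> D" for d using closed[OF that] h by (auto simp: H_def)
      then show ?thesis using edge_commute[of h] by auto
    qed
    then have "card (nbrs E H h) = card (nbrs E V h)"
      using nbrs_split[of D h] DV unfolding H_def by auto
    then show ?thesis using degree h by (simp add: H_def)
  qed
  have inA: "2 \<le> card (nbrs E H a)" if "a \<in> A" for a
    using is_cycle_degree[OF cycle _ CH finH] that by (auto simp: A_def)
  have "2 * card A + 3 * card (H - A) \<le> (\<Sum>h\<in>A. card (nbrs E H h)) + (\<Sum>h\<in>H - A. card (nbrs E H h))"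
    using sum_bounded_below[of A 2 "\<lambda>h. card (nbrs E H h)"]
      sum_bounded_below[of "H - A" 3 "\<lambda>h. card (nbrs E H h)"] inA nonA by simp
  also have "\<dots> = 2 * card {e \<in> E. e \<subseteq> H}"
    using sum_card_nbrs[OF graph, of H] sum.subset_diff[OF AH finH, of "\<lambda>h. card (nbrs E H h)"]
    by (simp add: H_def)
  finally have deg: "2 * card A + 3 * card (H - A) \<le> 2 * card {e \<in> E. e \<subseteq> H}" .
  have cH: "card H = card A + card (H - A)"
    using card_Diff_subset[OF finA AH] card_mono[OF finH AH] by simp
  have finD: "finite D" using DV finite_V finite_subset by auto
  have cD: "card V = card H + card D"
    using card_Diff_subset[OF finD, of V] card_mono[OF finite_V, of D] DV unfolding H_def
    by (metis Diff_subset le_add_diff_inverse2 order_trans)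
  obtain y where y: "y \<in> Y" using Y_nonempty by auto
  let ?EH = "{e \<in> E. e \<subseteq> H}"
    and ?EX = "{e \<in> E. e \<subseteq> V - Y \<and> e \<inter> (D - Y) \<noteq> {}}"
    and ?EY = "{e \<in> E. e \<subseteq> Y \<and> e \<inter> (Y - {y}) \<noteq> {}}"
  have "C \<noteq> []" using cycle by (auto simp: is_cycle_def)
  then have "hd C \<in> set C" by simp
  \<comment> \<open>Strictness comes from a cycle vertex. Within \<open>Y\<close> below, one vertex
    \<open>y\<close> is left out for the same reason.\<close>
  then have "D - Y \<subset> V - Y" using DV C_subset by blast
  from card_incident_edges_ge[OF graph compl_connected this] have EX: "card D - card Y \<le> card ?EX"
    using card_Diff_subset[OF finite_Y YD] by simp
  have "Y - {y} \<subset> Y" using y by auto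
  from card_incident_edges_ge[OF graph Y_connected this] have EY: "card Y - 1 \<le> card ?EY"
    using y finite_Y by simp
  have fin: "finite ?EH" "finite ?EX" "finite ?EY" "finite (edge_cut V E Y)"
    using finite_E finite_subset[OF edge_cut_subset] by auto
  have cut: "\<not> e \<subseteq> Y" "\<not> e \<subseteq> V - Y" if "e \<in> edge_cut V E Y" for e
    using that by (auto simp: edge_cut_def)
  have HY: "H \<subseteq> V - Y" "H \<inter> D = {}" using YD by (auto simp: H_def)
  have d1: "?EH \<inter> ?EX = {}" using HY by blast
  have d2: "(?EH \<union> ?EX) \<inter> ?EY = {}" using HY by blast
  have d3: "(?EH \<union> ?EX \<union> ?EY) \<inter> edge_cut V E Y = {}" using HY cut by blast
  have "card ?EH + card ?EX + card ?EY + card (edge_cut V E Y) = card (?EH \<union> ?EX \<union> ?EY \<union> edge_cut V E Y)"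
    using d1 d2 d3 fin by (simp add: card_Un_disjoint)
  also have "\<dots> \<le> card E" by (rule card_mono[OF finite_E]) (use edge_cut_subset in auto)
  finally have "card ?EH + card ?EX + card ?EY \<le> card V + 1" using E_le by simp
  moreover have "card Y \<le> card D" using card_mono[OF finD YD] .
  \<comment> \<open>The terms \<open>card D - card Y\<close> and \<open>card Y - 1\<close> add up to
    \<open>card D - 1\<close>.\<close>
  ultimately have "card ?EH \<le> card H + 2" using EX EY cD two_le_card_Y by linarith
  \<comment> \<open>From \<open>2 * card A + 3 * card (H - A) \<le> 2 * card H + 4\<close>.\<close>
  then have "card (H - A) \<le> 4" using deg cH by linarith
  moreover have "{v \<in> set C. nbrs E D v = {}} \<subseteq> H - A" using CH by (auto simp: A_def)
  ultimately have "card {v \<in> set C. nbrs E D v = {}} \<le> 4"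
    using card_mono[of "H - A"] finH by (meson finite_Diff le_trans)
  then have "card D \<le> 1" using separated_off_cycle[OF D_con _ closed] DV by blast
  then show False using two_le_card_Y card_mono[OF finD YD] by simp
qed

end

section \<open>From a counterexample to the contradiction\<close>

text \<open>The vertices of the cycle are connected through its own edges, so a cycle with vertices
  on both sides has an edge in the cut.\<close>

lemma cycle_on_one_side:
  assumes C: "is_cycle V E C" and disj: "cycle_edges C \<inter> edge_cut V E X = {}"
  shows "set C \<inter> X = {} \<or> set C \<inter> (V - X) = {}"
proof (rule ccontr)
  assume n: "\<not> ?thesis"
  have CE: "cycle_edges C \<subseteq> E" using C by (auto simp: cycle_edges_def is_cycle_def)
  have "is_cycle V (cycle_edges C) C" using C by (auto simp: cycle_edges_def is_cycle_def)
  then have "successively (\<lambda>x y. {x, y} \<in> cycle_edges C) C" "set C \<subseteq> V"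
    by (auto simp: is_cycle_iff successively_append_iff)
  then have "induced_connected V (cycle_edges C) (set C)" by (rule induced_connected_path)
  moreover have "set C \<inter> X \<subseteq> set C" "set C \<inter> X \<noteq> {}" "set C \<inter> X \<noteq> set C" using n by auto
  ultimately obtain t s where ts: "t \<in> set C \<inter> X" "s \<in> set C - set C \<inter> X" "{t, s} \<in> cycle_edges C"
    using induced_connected_edge by metis
  then have "{t, s} \<in> edge_cut V E X"
    using edge_cut_iff[of _ _ V E] CE \<open>set C \<subseteq> V\<close> by auto
  then show False using disj ts by auto
qed

theorem theorem1p4:
  fixes V :: "'a set" and E :: "'a set set"
  assumes "graph V E"
    and "k_connected 3 V E"
    and "int (circumference V E) \<ge> int (card V) - 3 \<or>
         int (max_bond_size V E) \<ge> int (card E) - int (card V) - 1"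
  shows "\<forall>C B. is_cycle V E C \<and> length C = circumference V E \<and>
           is_bond V E B \<and> card B = max_bond_size V E \<longrightarrow> cycle_edges C \<inter> B \<noteq> {}"
proof (intro allI impI notI, elim conjE)
  fix C B
  assume C: "is_cycle V E C" "length C = circumference V E"
    and B: "is_bond V E B" "card B = max_bond_size V E" and disj: "cycle_edges C \<inter> B = {}"
  have "induced_connected V E (V - {})"
    using assms(2) unfolding k_connected_def by (metis card.empty empty_subsetI zero_less_numeral)
  then have con: "connected_graph V E" by (simp add: connected_graph_def)
  obtain X where X: "X \<subseteq> V" "B = edge_cut V E X" "X \<noteq> {}" "V - X \<noteq> {}"
    "induced_connected V E X" "induced_connected V E (V - X)"
    using bond_obtain_sides[OF assms(1) con B(1)] .
  have dd: "V - (V - X) = X" using X(1) by auto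
  have "\<exists>Y. Y \<subseteq> V \<and> B = edge_cut V E Y \<and> Y \<noteq> {} \<and> induced_connected V E Y \<and>
    induced_connected V E (V - Y) \<and> Y \<inter> set C = {}"
    using cycle_on_one_side[OF C(1) disj[unfolded X(2)]]
  proof
    assume "set C \<inter> X = {}"
    then show ?thesis using X by (intro exI[of _ X]) auto
  next
    assume "set C \<inter> (V - X) = {}"
    then show ?thesis using X dd edge_cut_compl[OF assms(1) X(1)] by (intro exI[of _ "V - X"]) auto
  qed
  then obtain Y where Y: "Y \<subseteq> V" "B = edge_cut V E Y" "Y \<noteq> {}" "induced_connected V E Y"
    "induced_connected V E (V - Y)" "Y \<inter> set C = {}" by blast
  interpret longest_cycle_off_largest_bond V E C Y
  proof
    show "length C' \<le> length C" if "is_cycle V E C'" for C'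
      using cycle_le_circumference[OF assms(1) that] C(2) by simp
    show "card (edge_cut V E Z) \<le> card (edge_cut V E Y)"
      if "Z \<subseteq> V" "Z \<noteq> {}" "V - Z \<noteq> {}" "induced_connected V E Z" "induced_connected V E (V - Z)" for Z
      using bond_le_max_bond_size[OF assms(1) is_bondI[OF assms(1) con that]] B(2) Y(2) by simp
  qed (use assms C Y in auto)
  have "card (edge_cut V E Y) = max_bond_size V E" using B(2) Y(2) by simp
  \<comment> \<open>The first alternative contradicts \<open>four_le_card_off_cycle\<close>, the
    second \<open>many_edges_off_cut\<close>.\<close>
  then show False
    using assms(3) four_le_card_off_cycle many_edges_off_cut C(2) by auto
qed

end
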